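(* Let $\mathbb{T}$ be a time scale, let $n\in\mathbb{N}$, $s\in\mathbb{T}^{\kappa^{n-1}}$, $p_i,q\in C_{rd}(\mathbb{T},\mathbb{R})$ for $i=1,2,\dots,n$, and let $y_0,y_1,\dots,y_{n-1}$ be real constants. If a function $y\in C_{rd}^{n}(\mathbb{T},\mathbb{R})$ solves the initial value problem $$y^{\Delta^{n}}(t)+\sum_{i=0}^{n-1}p_{n-i}(t)y^{\Delta^{i}}(t)=q(t)\ \text{ for } t\in\mathbb{T}^{\kappa^{n}},\qquad y^{\Delta^{i}}(s)=y_i\ \text{ for } i=0,1,\dots,n-1,$$ then $\varphi:=y^{\Delta^{n}}$ solves $$\varphi(t)=-\int_s^t\sum_{i=0}^{n-1}p_{n-i}(t)\,h_{n-i-1}(t,\sigma(\eta))\,\varphi(\eta)\,\Delta\eta+q(t)-\sum_{i=0}^{n-1}\sum_{k=0}^{n-i-1}y_{k+i}\,p_{n-i}(t)\,h_k(t,s)\quad\text{for } t\in\mathbb{T}^{\kappa^{n}}.$$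
   Context: A time scale $\mathbb{T}$ is a nonempty closed subset of $\mathbb{R}$ with the topology inherited from $\mathbb{R}$; a subscript $\mathbb{T}$ on an interval denotes its intersection with $\mathbb{T}$. For $t\in\mathbb{T}$, $\sigma(t):=\inf(t,\infty)_{\mathbb{T}}$ and $\rho(t):=\sup(-\infty,t)_{\mathbb{T}}$ (with $\inf\emptyset=\sup\mathbb{T}$, $\sup\emptyset=\inf\mathbb{T}$). A point $t$ is right-dense if $\sigma(t)=t$ and left-dense if $\rho(t)=t$. $\mathbb{T}^{\kappa}:=\mathbb{T}\setminus\{\sup\mathbb{T}\}$ if $\sup\mathbb{T}=\max\mathbb{T}$ and $\rho(\max\mathbb{T})\ne\max\mathbb{T}$, and $\mathbb{T}^{\kappa}:=\mathbb{T}$ otherwise; $\mathbb{T}^{\kappa^0}:=\mathbb{T}$, $\mathbb{T}^{\kappa^{n}}:=(\mathbb{T}^{\kappa^{n-1}})^{\kappa}$. A function is rd-continuous if it is continuous at right-dense points and has finite (left-sided) limits at left-dense points; $C_{rd}(\mathbb{T},\mathbb{R})$ denotes the set of rd-continuous functions $\mathbb{T}\to\mathbb{R}$. The $\Delta$-derivative $g^{\Delta}(t)$ is the number $\ell$ such that for every $\varepsilon>0$ there is a neighborhood $U$ of $t$ with $|[g(\sigma(t))-g(r)]-\ell[\sigma(t)-r]|\le\varepsilon|\sigma(t)-r|$ for all $r\in U$; $g^{\Delta^0}:=g$ and $g^{\Delta^{i}}:=(g^{\Delta^{i-1}})^{\Delta}$, and $C_{rd}^{n}(\mathbb{T},\mathbb{R})$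 is the set of functions that are $n$ times $\Delta$-differentiable with rd-continuous $n$-th $\Delta$-derivative (on $\mathbb{T}^{\kappa^n}$). The $\Delta$-integral is $\int_s^t g(\eta)\,\Delta\eta=G(t)-G(s)$, where $G$ is a $\Delta$-antiderivative of $g$, i.e. $G^{\Delta}=g$. The generalized monomials $h_k:\mathbb{T}\times\mathbb{T}\to\mathbb{R}$ are $h_0(t,s):=1$ and $h_k(t,s):=\int_s^t h_{k-1}(\eta,s)\,\Delta\eta$ for $k\in\mathbb{N}=\{1,2,\dots\}$. *)

theory Defs
  imports "HOL-Analysis.Analysis"
begin

text \<open>
  A function on a time scale \<open>T\<close>, or on a subset of it, is represented by a total function
  \<open>real \<Rightarrow> real\<close>; only its values on the set in question are ever used.
\<close>

definition time_scale :: "real set \<Rightarrow> bool" where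
  "time_scale T \<longleftrightarrow> T \<noteq> {} \<and> closed T"

definition fjump :: "real set \<Rightarrow> real \<Rightarrow> real" where
  "fjump T t = (if {r \<in> T. t < r} = {} then Sup T else Inf {r \<in> T. t < r})"

definition bjump :: "real set \<Rightarrow> real \<Rightarrow> real" where
  "bjump T t = (if {r \<in> T. r < t} = {} then Inf T else Sup {r \<in> T. r < t})"

text \<open>
  For closed nonempty \<open>T\<close>, boundedness above means that \<open>Sup T\<close> is the maximum of \<open>T\<close>.
  By the convention for the supremum of the empty set, a one-point time scale satisfies
  \<open>kappa T = T\<close>. The iterate \<open>(kappa ^^ n) T\<close> is obtained by applying \<open>kappa\<close> to \<open>T\<close> \<open>n\<close> times.
\<close>

definition kappa :: "real set \<Rightarrow> real set" where
  "kappa T = (if bdd_above T \<and> bjump T (Sup T) \<noteq> Sup T then T - {Sup T} else T)"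

text \<open>
  Rd-continuity of a function with domain \<open>D \<subseteq> T\<close>. Right-dense and left-dense are meant with
  respect to \<open>T\<close>, so that on \<open>D = kappa T\<close> no continuity is imposed at a left-dense maximum of \<open>D\<close>
  that is right-scattered in \<open>T\<close>.
\<close>

definition rd_continuous_on :: "real set \<Rightarrow> real set \<Rightarrow> (real \<Rightarrow> real) \<Rightarrow> bool" where
  "rd_continuous_on T D g \<longleftrightarrow>
    (\<forall>t\<in>D. (fjump T t = t \<longrightarrow> continuous (at t within D) g) \<and>
           (bjump T t = t \<longrightarrow> (\<exists>l. (g \<longlongrightarrow> l) (at t within (D \<inter> {..<t})))))"

definition Crd :: "real set \<Rightarrow> (real \<Rightarrow> real) set" where
  "Crd T = {g. rd_continuous_on T T g}"

definition has_delta_deriv :: "real set \<Rightarrow> (real \<Rightarrow> real) \<Rightarrow> real \<Rightarrow> real \<Rightarrow> bool" where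
  "has_delta_deriv T g l t \<longleftrightarrow>
    (\<forall>\<epsilon>>0. \<exists>U. open U \<and> t \<in> U \<and>
      (\<forall>r\<in>U \<inter> T. \<bar>(g (fjump T t) - g r) - l * (fjump T t - r)\<bar> \<le> \<epsilon> * \<bar>fjump T t - r\<bar>))"

text \<open>
  The derivative is unique at every point of \<open>kappa T\<close> unless \<open>T\<close> is a single point, where every
  real number satisfies the defining condition.
\<close>

definition delta_deriv :: "real set \<Rightarrow> (real \<Rightarrow> real) \<Rightarrow> real \<Rightarrow> real" where
  "delta_deriv T g t = (SOME l. has_delta_deriv T g l t)"

text \<open>
  The \<open>i\<close>-th derivative is a function on the time scale \<open>(kappa ^^ i) T\<close>, and it is differentiated
  as such: its value at the forward jump of a point taken in \<open>T\<close> may be undefined, as for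
  \<open>T = {0..1} \<union> {2}\<close> at the point 1.
\<close>

primrec delta_derivs :: "real set \<Rightarrow> nat \<Rightarrow> (real \<Rightarrow> real) \<Rightarrow> real \<Rightarrow> real" where
  "delta_derivs T 0 g = g"
| "delta_derivs T (Suc i) g = delta_deriv ((kappa ^^ i) T) (delta_derivs T i g)"

definition Crdn :: "real set \<Rightarrow> nat \<Rightarrow> (real \<Rightarrow> real) set" where
  "Crdn T n =
    {g. (\<forall>i<n. \<forall>t\<in>(kappa ^^ Suc i) T. \<exists>l. has_delta_deriv ((kappa ^^ i) T) (delta_derivs T i g) l t) \<and>
        rd_continuous_on T ((kappa ^^ n) T) (delta_derivs T n g)}"

text \<open>
  The integrand may be defined only on a subset \<open>D\<close> of \<open>kappa T\<close>. The integral from \<open>s\<close> to \<open>t\<close> does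
  not depend on the antiderivative as long as \<open>D\<close> contains every point of \<open>T\<close> in the half-open
  interval from \<open>min s t\<close> (inclusive) to \<open>max s t\<close> (exclusive), and the antiderivative is
  continuous at \<open>max s t\<close>. This holds for \<open>D = kappa T\<close> and \<open>s, t \<in> T\<close>, and for
  \<open>D = (kappa ^^ n) T\<close> and \<open>s, t \<in> (kappa ^^ (n - 1)) T\<close> with \<open>n \<ge> 1\<close>.
\<close>

definition delta_antideriv ::
    "real set \<Rightarrow> real set \<Rightarrow> (real \<Rightarrow> real) \<Rightarrow> (real \<Rightarrow> real) \<Rightarrow> bool" where
  "delta_antideriv T D g G \<longleftrightarrow> (\<forall>t\<in>D. has_delta_deriv T G (g t) t)"

definition delta_integral ::
    "real set \<Rightarrow> real set \<Rightarrow> real \<Rightarrow> real \<Rightarrow> (real \<Rightarrow> real) \<Rightarrow> real" where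
  "delta_integral T D s t g = (THE I. \<exists>G. delta_antideriv T D g G \<and> I = G t - G s)"

primrec monomial_h :: "real set \<Rightarrow> nat \<Rightarrow> real \<Rightarrow> real \<Rightarrow> real" where
  "monomial_h T 0 = (\<lambda>t s. 1)"
| "monomial_h T (Suc k) = (\<lambda>t s. delta_integral T (kappa T) s t (\<lambda>\<eta>. monomial_h T k \<eta> s))"

end

theory Submission
  imports Defs
begin

text \<open>
  Fix \<open>t\<close> in the domain of the highest derivative \<open>\<phi>\<close>. The integral equation is obtained
  by inserting Taylor's formula at \<open>t\<close>, with centre \<open>s\<close>, for every lower derivative of
  \<open>y\<close> into the differential equation. As a function of its centre \<open>x\<close>, the Taylor
  polynomial
  \<open>\<Sum>k\<le>n - i - 1. delta_derivs T (k + i) y x * monomial_h T k t x\<close> of the derivative of order \<open>i\<close>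
  has delta derivative
  \<open>monomial_h T (n - i - 1) t (fjump T x) * \<phi> x\<close>: the product rule makes the sum telescope
  (lemma \<open>has_delta_deriv_telescope\<close>). Weighting by \<open>p (n - i) t\<close> and summing over \<open>i\<close> gives
  an explicit antiderivative \<open>F\<close> of the integrand, so the integral is \<open>F t - F s\<close>. Here
  \<open>F s\<close> is the double sum over the initial values and
  \<open>F t = (\<Sum>i<n. p (n - i) t * delta_derivs T i y t)\<close>, which the differential equation equates with
  \<open>q t - \<phi> t\<close>.

  Three points need work. The telescoping requires the derivative of the monomials in their second
  argument, \<open>- monomial_h T k t (fjump T x)\<close> for the monomial of index \<open>k + 1\<close>
  (\<open>monomial_h_deriv_second\<close>); it follows from a second telescoping sum, once antiderivatives of
  \<open>f\<close> and \<open>f \<circ> fjump T\<close> are known to exist for continuous \<open>f\<close>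
  (\<open>delta_antideriv_exists\<close>). The integral is well defined because a function with vanishing
  derivative is constant, also when the upper end point is missing from the domain of the integrand
  (\<open>delta_deriv_zero_imp_eq_initial_part\<close>). Finally, the derivatives of \<open>y\<close> are taken on
  shrinking time scales but the integral on \<open>T\<close>; they are reconciled by a linear continuation
  above the maximum of \<open>(kappa ^^ (n - 1)) T\<close> (\<open>has_delta_deriv_extend_linearly\<close>).
\<close>

section \<open>The forward jump\<close>

lemma fjump_greatest: 
  assumes "time_scale T" "t \<in> T" "r \<in> T" "t < r"
  shows "fjump T t \<le> r"
proof -
  have "bdd_below {r \<in> T. t < r}" by (rule bdd_belowI[of _ t]) auto
  then show ?thesis using assms unfolding fjump_def by (auto intro!: cInf_lower)
qed

lemma fjump_max: 
  assumes "t \<in> T" "{r \<in> T. t < r} = {}"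
  shows "fjump T t = t"
proof -
  have "Sup T = t" using assms by (intro cSup_eq_maximum) force+
  then show ?thesis using assms unfolding fjump_def by simp
qed

lemma fjump_ge: 
  assumes "t \<in> T"
  shows "t \<le> fjump T t"
proof (cases "{r \<in> T. t < r} = {}")
  case True then show ?thesis using fjump_max[OF assms] by simp
next
  case False
  then show ?thesis unfolding fjump_def by (auto intro!: cInf_greatest)
qed

lemma fjump_mem: 
  assumes "time_scale T" "t \<in> T"
  shows "fjump T t \<in> T"
proof (cases "{r \<in> T. t < r} = {}")
  case True then show ?thesis using fjump_max assms by simp
next
  case False
  have "Inf {r \<in> T. t < r} \<in> closure {r \<in> T. t < r}"
    using False by (intro closure_contains_Inf bdd_belowI[of _ t]) auto
  also have "\<dots> \<subseteq> T" using assms by (intro closure_minimal) (auto simp: time_scale_def)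
  finally show ?thesis using False unfolding fjump_def by (simp only: if_False)
qed

lemma fjump_eqI: 
  assumes "time_scale T" "t \<in> T" "d \<in> T" "t < d" "T \<inter> {t<..<d} = {}"
  shows "fjump T t = d"
proof -
  have "Inf {r \<in> T. t < r} = d" using assms by (intro cInf_eq_minimum) force+
  then show ?thesis using assms by (auto simp: fjump_def)
qed

lemma fjump_mono: 
  assumes "time_scale T" 
  shows "mono_on T (fjump T)"
proof (rule mono_onI)
  fix r t assume *: "r \<in> T" "t \<in> T" "r \<le> t"
  show "fjump T r \<le> fjump T t"
  proof (cases "r = t")
    case False
    then show ?thesis using * fjump_greatest[OF assms, of r t] fjump_ge[of t T] by simp
  qed simp
qed

text \<open>
  The forward jump is discontinuous at left-dense right-scattered points. At a
  right-dense point the points on either side jump no further than the nearby points of \<open>T\<close>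
  enclosing them, which is what rd-continuity of \<open>F \<circ> fjump T\<close> rests on.
\<close>

lemma fjump_continuous_right_dense: 
  assumes T: "time_scale T" and t: "t \<in> T" "fjump T t = t"
  shows "continuous (at t within T) (fjump T)"
  unfolding continuous_within_eps_delta
proof (intro allI impI)
  fix e :: real assume e: "e > 0"
  show "\<exists>d>0. \<forall>r\<in>T. dist r t < d \<longrightarrow> dist (fjump T r) (fjump T t) < e"
  proof (cases "\<exists>x\<in>T. t < x")
    case False
    have "dist (fjump T r) (fjump T t) < e" if "r \<in> T" "dist r t < e" for r
    proof -
      have "r \<le> t" using False that by force
      then have "fjump T r \<le> t" "r \<le> fjump T r"
        using fjump_mono[OF T] that t fjump_ge[of r T] by (auto dest: mono_onD[where r=r and s=t])
      then show ?thesis using that t by (auto simp: dist_real_def)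
    qed
    then show ?thesis using e by blast
  next
    case True
    have "\<exists>x\<in>T. t < x \<and> x < t + e"
    proof (rule ccontr)
      assume c: "\<not> (\<exists>x\<in>T. t < x \<and> x < t + e)"
      have "t + e \<le> Inf {r \<in> T. t < r}" using True c by (intro cInf_greatest) (auto simp: not_less)
      moreover have "fjump T t = Inf {r \<in> T. t < r}" using True by (auto simp: fjump_def)
      ultimately show False using t e by simp
    qed
    then obtain x where x: "x \<in> T" "t < x" "x < t + e" by blast
    have "dist (fjump T r) (fjump T t) < e" if r: "r \<in> T" "dist r t < min e (x - t)" for r
    proof -
      have "r < x" using r by (auto simp: dist_real_def)
      then have "fjump T r \<le> x" using fjump_greatest T r x by blast
      then show ?thesis using r x t fjump_ge[of r T] by (auto simp: dist_real_def)
    qed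
    then show ?thesis using e x by (intro exI[of _ "min e (x - t)"]) auto
  qed
qed

section \<open>The delta derivative\<close>

text \<open>
  The defining inequality mixes two situations. At a right-scattered point it forces the slope over
  the gap (take \<open>r = t\<close>) and, through \<open>r \<rightarrow> t\<close>, continuity; at a point with
  \<open>fjump T t = t\<close> it is the ordinary derivative within \<open>T\<close>. Separating continuity, the jump
  formula (valid in both situations) and the ordinary derivative lets the calculus rules below be
  read off from those for limits and derivatives within a set.
\<close>

lemma has_delta_deriv_iff: 
  assumes T: "time_scale T" and t: "t \<in> T"
  shows "has_delta_deriv T g l t \<longleftrightarrow>
    continuous (at t within T) g \<and> g (fjump T t) = g t + l * (fjump T t - t) \<and>
    (fjump T t = t \<longrightarrow> (g has_real_derivative l) (at t within T))"
proof (cases "fjump T t = t")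
  case True
  have "has_delta_deriv T g l t \<longleftrightarrow> (g has_real_derivative l) (at t within T)"
  proof
    assume h: "has_delta_deriv T g l t"
    show "(g has_real_derivative l) (at t within T)"
      unfolding has_field_derivative_def has_derivative_within_alt
    proof (intro conjI allI impI)
      fix e :: real assume "e > 0"
      then obtain U where U: "open U" "t \<in> U"
        "\<forall>r\<in>U \<inter> T. \<bar>(g t - g r) - l * (t - r)\<bar> \<le> e * \<bar>t - r\<bar>"
        using h True unfolding has_delta_deriv_def by metis
      then obtain d where d: "d > 0" "ball t d \<subseteq> U" by (meson openE)
      have "norm (g r - g t - l * (r - t)) \<le> e * norm (r - t)" if "r \<in> T" "norm (r - t) < d" for r
      proof -
        have "r \<in> U \<inter> T" using d that by (auto simp: dist_real_def abs_minus_commute)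
        then have "\<bar>(g t - g r) - l * (t - r)\<bar> \<le> e * \<bar>t - r\<bar>" using U by blast
        then show ?thesis by (simp add: algebra_simps abs_if split: if_splits)
      qed
      then show "\<exists>d>0. \<forall>r\<in>T. norm (r - t) < d \<longrightarrow> norm (g r - g t - l * (r - t)) \<le> e * norm (r - t)"
        using d by blast
    qed (rule bounded_linear_mult_right)
  next
    assume h: "(g has_real_derivative l) (at t within T)"
    show "has_delta_deriv T g l t"
      unfolding has_delta_deriv_def True
    proof (intro allI impI)
      fix e :: real assume "e > 0"
      then obtain d where d: "d > 0"
        "\<forall>r\<in>T. norm (r - t) < d \<longrightarrow> norm (g r - g t - l * (r - t)) \<le> e * norm (r - t)"
        using h unfolding has_field_derivative_def has_derivative_within_alt by metis
      have "\<bar>(g t - g r) - l * (t - r)\<bar> \<le> e * \<bar>t - r\<bar>" if "r \<in> ball t d \<inter> T" for r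
      proof -
        have "norm (g r - g t - l * (r - t)) \<le> e * norm (r - t)"
          using d that by (auto simp: dist_real_def abs_minus_commute)
        then show ?thesis by (simp add: algebra_simps abs_if split: if_splits)
      qed
      then show "\<exists>U. open U \<and> t \<in> U \<and> (\<forall>r\<in>U \<inter> T. \<bar>g t - g r - l * (t - r)\<bar> \<le> e * \<bar>t - r\<bar>)"
        using d(1) by (intro exI[of _ "ball t d"]) auto
    qed
  qed
  then show ?thesis using True DERIV_continuous by auto
next
  case False
  define m where "m = fjump T t - t"
  have m: "m > 0" "fjump T t = t + m" using False fjump_ge[OF t] by (auto simp: m_def)
  show ?thesis
  proof
    assume h: "has_delta_deriv T g l t"
    have "\<bar>g (fjump T t) - g t - l * m\<bar> \<le> 0 + e" if e: "e > 0" for e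
    proof -
      have "e / m > 0" using e m by simp
      then obtain U where "t \<in> U"
        "\<forall>r\<in>U \<inter> T. \<bar>(g (fjump T t) - g r) - l * (fjump T t - r)\<bar> \<le> e / m * \<bar>fjump T t - r\<bar>"
        using h unfolding has_delta_deriv_def by metis
      then have "\<bar>(g (fjump T t) - g t) - l * (fjump T t - t)\<bar> \<le> e / m * \<bar>fjump T t - t\<bar>" using t by blast
      then show ?thesis using m by simp
    qed
    then have "\<bar>g (fjump T t) - g t - l * m\<bar> \<le> 0" by (rule field_le_epsilon)
    then have jump: "g (fjump T t) = g t + l * m" by simp
    moreover have "continuous (at t within T) g"
      unfolding continuous_within_eps_delta
    proof (intro allI impI)
      fix e :: real assume e: "e > 0"
      define e' where "e' = e / (2 * (m + 1))"
      have e': "e' > 0" "e' * (m + 1) = e / 2" using e m by (auto simp: e'_def field_simps)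
      obtain U where U: "open U" "t \<in> U"
        "\<forall>r\<in>U \<inter> T. \<bar>(g (fjump T t) - g r) - l * (fjump T t - r)\<bar> \<le> e' * \<bar>fjump T t - r\<bar>"
        using h e' unfolding has_delta_deriv_def by metis
      then obtain d where d: "d > 0" "ball t d \<subseteq> U" by (meson openE)
      define d' where "d' = min (min d 1) (e / (2 * (\<bar>l\<bar> + 1)))"
      have "dist (g r) (g t) < e" if r: "r \<in> T" "dist r t < d'" for r
      proof -
        have "r \<in> U \<inter> T" using d r by (auto simp: d'_def dist_commute)
        then have "\<bar>(g (fjump T t) - g r) - l * (fjump T t - r)\<bar> \<le> e' * \<bar>fjump T t - r\<bar>" using U by blast
        also have "\<dots> \<le> e' * (m + 1)"
          using e' r m by (intro mult_left_mono) (auto simp: d'_def dist_real_def)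
        finally have 1: "\<bar>g t - g r - l * (t - r)\<bar> \<le> e / 2"
          using e' jump m by (simp add: algebra_simps)
        have "\<bar>l * (t - r)\<bar> \<le> (\<bar>l\<bar> + 1) * \<bar>t - r\<bar>" by (simp add: abs_mult mult_right_mono)
        also have "\<dots> < (\<bar>l\<bar> + 1) * (e / (2 * (\<bar>l\<bar> + 1)))"
          using r by (intro mult_strict_left_mono) (auto simp: d'_def dist_real_def)
        also have "\<dots> = e / 2" by (simp add: field_simps) 
        finally show ?thesis using 1 unfolding dist_real_def by linarith
      qed
      moreover have "d' > 0" using d e by (auto simp: d'_def)
      ultimately show "\<exists>d>0. \<forall>r\<in>T. dist r t < d \<longrightarrow> dist (g r) (g t) < e" by blast
    qed
    ultimately show "continuous (at t within T) g \<and> g (fjump T t) = g t + l * (fjump T t - t) \<and>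
      (fjump T t = t \<longrightarrow> (g has_real_derivative l) (at t within T))" using False by (simp add: m_def)
  next
    assume h: "continuous (at t within T) g \<and> g (fjump T t) = g t + l * (fjump T t - t) \<and>
      (fjump T t = t \<longrightarrow> (g has_real_derivative l) (at t within T))"
    show "has_delta_deriv T g l t"
      unfolding has_delta_deriv_def
    proof (intro allI impI)
      fix e :: real assume e: "e > 0"
      have "continuous (at t within T) (\<lambda>r. \<bar>(g t - g r) - l * (t - r)\<bar> - e * \<bar>fjump T t - r\<bar>)"
        using h by (intro continuous_intros) auto
      then have "((\<lambda>r. \<bar>(g t - g r) - l * (t - r)\<bar> - e * \<bar>fjump T t - r\<bar>) \<longlongrightarrow> - (e * m)) (at t within T)"
        using m by (simp add: continuous_within)
      then have "\<forall>\<^sub>F r in at t within T. \<bar>(g t - g r) - l * (t - r)\<bar> - e * \<bar>fjump T t - r\<bar> < 0"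
        using m e by (intro order_tendstoD(2)) auto
      then obtain U where U: "open U" "t \<in> U"
        "\<forall>r\<in>U. r \<noteq> t \<longrightarrow> r \<in> T \<longrightarrow> \<bar>(g t - g r) - l * (t - r)\<bar> - e * \<bar>fjump T t - r\<bar> < 0"
        unfolding eventually_at_topological by blast
      have "\<bar>(g (fjump T t) - g r) - l * (fjump T t - r)\<bar> \<le> e * \<bar>fjump T t - r\<bar>" if "r \<in> U \<inter> T" for r
      proof -
        have eq: "(g (fjump T t) - g r) - l * (fjump T t - r) = (g t - g r) - l * (t - r)"
          using h by (simp add: algebra_simps)
        show ?thesis
          unfolding eq using U that e by (cases "r = t") force+
      qed
      then show "\<exists>U. open U \<and> t \<in> U \<and>
        (\<forall>r\<in>U \<inter> T. \<bar>(g (fjump T t) - g r) - l * (fjump T t - r)\<bar> \<le> e * \<bar>fjump T t - r\<bar>)"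
        using U by blast
    qed
  qed
qed

lemma delta_deriv_continuous:
  assumes "time_scale T" "t \<in> T" "has_delta_deriv T g l t"
  shows "continuous (at t within T) g"
  using assms has_delta_deriv_iff by blast

lemma delta_deriv_jump:
  assumes "time_scale T" "t \<in> T" "has_delta_deriv T g l t"
  shows "g (fjump T t) = g t + l * (fjump T t - t)"
  using assms has_delta_deriv_iff by blast

lemma has_delta_deriv_cong:
  assumes "time_scale T" "t \<in> T" "\<And>r. r \<in> T \<Longrightarrow> f r = g r"
  shows "has_delta_deriv T f l t \<longleftrightarrow> has_delta_deriv T g l t"
  using assms fjump_mem[OF assms(1,2)] unfolding has_delta_deriv_def by simp

lemma has_delta_deriv_const:
  assumes "time_scale T" "t \<in> T"
  shows "has_delta_deriv T (\<lambda>_. c) 0 t"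
  using assms by (simp add: has_delta_deriv_iff)

lemma has_delta_deriv_add:
  assumes "time_scale T" "t \<in> T" "has_delta_deriv T f a t" "has_delta_deriv T g b t"
  shows "has_delta_deriv T (\<lambda>x. f x + g x) (a + b) t"
  using assms by (auto simp: has_delta_deriv_iff algebra_simps intro!: continuous_intros derivative_intros)

lemma has_delta_deriv_mult:
  assumes T: "time_scale T" "t \<in> T" and f: "has_delta_deriv T f a t" and g: "has_delta_deriv T g b t"
  shows "has_delta_deriv T (\<lambda>x. f x * g x) (a * g (fjump T t) + f t * b) t"
  unfolding has_delta_deriv_iff[OF T]
proof (intro conjI impI)
  show "continuous (at t within T) (\<lambda>x. f x * g x)"
    using delta_deriv_continuous[OF T] f g by (intro continuous_intros)
  show "f (fjump T t) * g (fjump T t) = f t * g t + (a * g (fjump T t) + f t * b) * (fjump T t - t)"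
    using delta_deriv_jump[OF T f] delta_deriv_jump[OF T g] by algebra
  assume "fjump T t = t"
  then show "((\<lambda>x. f x * g x) has_real_derivative a * g (fjump T t) + f t * b) (at t within T)"
    using f g T by (auto simp: has_delta_deriv_iff intro!: derivative_eq_intros)
qed

lemma has_delta_deriv_cmult:
  assumes "time_scale T" "t \<in> T" "has_delta_deriv T f a t"
  shows "has_delta_deriv T (\<lambda>x. c * f x) (c * a) t"
  using has_delta_deriv_mult[OF assms(1,2) has_delta_deriv_const[OF assms(1,2)] assms(3)] by simp

lemma has_delta_deriv_diff:
  assumes "time_scale T" "t \<in> T" "has_delta_deriv T f a t" "has_delta_deriv T g b t"
  shows "has_delta_deriv T (\<lambda>x. f x - g x) (a - b) t"
  using has_delta_deriv_add[OF assms(1-3) has_delta_deriv_cmult[OF assms(1,2,4), of "-1"]] by simp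

lemma has_delta_deriv_sum:
  assumes "time_scale T" "t \<in> T" "finite I" "\<And>i. i \<in> I \<Longrightarrow> has_delta_deriv T (f i) (a i) t"
  shows "has_delta_deriv T (\<lambda>x. \<Sum>i\<in>I. f i x) (\<Sum>i\<in>I. a i) t"
  using assms(3,4)
proof (induction I rule: finite_induct)
  case empty
  then show ?case using assms has_delta_deriv_const by simp
next
  case (insert i I)
  then show ?case using has_delta_deriv_add[OF assms(1,2), of "f i" "a i"] by simp
qed

text \<open>
  This is repeated integration by parts in one step. By the product rule the summand with index
  \<open>k\<close> contributes \<open>u (Suc k) x * v k (fjump T x)\<close>, and for \<open>k > 0\<close> also minus the same
  expression for \<open>k - 1\<close>, so only the top term survives. It serves twice: to exchange the arguments of the
  monomials, and to find the antiderivative behind Taylor's formula.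
\<close>

lemma has_delta_deriv_telescope:
  assumes T: "time_scale T" "x \<in> T"
    and u: "\<And>k. k \<le> m \<Longrightarrow> has_delta_deriv T (u k) (u (Suc k) x) x"
    and v0: "has_delta_deriv T (v 0) 0 x"
    and v: "\<And>k. k < m \<Longrightarrow> has_delta_deriv T (v (Suc k)) (- v k (fjump T x)) x"
  shows "has_delta_deriv T (\<lambda>x. \<Sum>k\<le>m. u k x * v k x) (u (Suc m) x * v m (fjump T x)) x"
  using u v
proof (induction m)
  case 0
  then show ?case using has_delta_deriv_mult[OF T _ v0, of "u 0"] by simp
next
  case (Suc m)
  then have "has_delta_deriv T (\<lambda>x. \<Sum>k\<le>m. u k x * v k x) (u (Suc m) x * v m (fjump T x)) x"
    by simp
  from has_delta_deriv_add[OF T this has_delta_deriv_mult[OF T Suc.prems(1)[of "Suc m"] Suc.prems(2)[of m]]]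
  show ?case by simp
qed

section \<open>Functions with vanishing delta derivative\<close>

text \<open>
  If \<open>\<bar>G x - G a\<bar>\<close> exceeded \<open>e * (x - a)\<close> somewhere, consider the infimum
  \<open>c\<close> of the points of \<open>T\<close> where it does. If \<open>c\<close> itself is such a point, it inherits
  the opposite inequality from the left, across the gap below it or by continuity. If it is not,
  it is right-dense, and the vanishing derivative at \<open>c\<close> rules out violations just above it.
  
  At the right end point \<open>b\<close> only continuity from the left is assumed: \<open>b\<close> may lie outside
  the set on which the derivative exists.
\<close>

lemma delta_deriv_zero_imp_eq:
  assumes T: "time_scale T" and ab: "a \<in> T" "b \<in> T" "a \<le> b"
    and d: "\<And>x. x \<in> T \<Longrightarrow> a \<le> x \<Longrightarrow> x < b \<Longrightarrow> has_delta_deriv T G 0 x"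
    and c: "(G \<longlongrightarrow> G b) (at b within T \<inter> {..<b})"
  shows "G a = G b"
proof -
  have main: "\<bar>G b - G a\<bar> \<le> e * (b - a)" if e: "e > 0" for e
  proof (rule ccontr)
    assume contra: "\<not> ?thesis"
    define B where "B = {x \<in> T. a \<le> x \<and> x \<le> b \<and> e * (x - a) < \<bar>G x - G a\<bar>}"
    define c where "c = Inf B"
    have "b \<in> B" using ab contra by (auto simp: B_def)
    have bdd: "bdd_below B" by (rule bdd_belowI[of _ a]) (auto simp: B_def)
    have "c \<in> closure B" unfolding c_def using \<open>b \<in> B\<close> bdd by (intro closure_contains_Inf) auto
    have lower: "c \<le> x" if "x \<in> B" for x unfolding c_def using that bdd by (rule cInf_lower)
    have "closure B \<subseteq> T \<inter> {a..b}"
      using T by (intro closure_minimal closed_Int) (auto simp: B_def time_scale_def)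
    then have cT: "c \<in> T" "a \<le> c" "c \<le> b" using \<open>c \<in> closure B\<close> by auto
    have good: "\<bar>G x - G a\<bar> \<le> e * (x - a)" if "x \<in> T" "a \<le> x" "x < c" for x
      using that lower[of x] cT by (force simp: B_def)
    show False
    proof (cases "c \<in> B")
      case True
      then have bad: "e * (c - a) < \<bar>G c - G a\<bar>" by (simp add: B_def)
      then have "a < c" using cT by (cases "a = c") auto
      define L where "L = T \<inter> {..<c}"
      have "a \<in> L" "bdd_above L" using \<open>a < c\<close> ab by (auto simp: L_def intro: bdd_aboveI[of _ c])
      then have SL: "Sup L \<in> closure L" "a \<le> Sup L" by (auto intro: closure_contains_Sup cSup_upper)
      have "closure L \<subseteq> T \<inter> {..c}" 
        using T by (intro closure_minimal closed_Int) (auto simp: L_def time_scale_def)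
      then have SLT: "Sup L \<in> T" "Sup L \<le> c" using SL by auto
      show False
      proof (cases "Sup L = c")
        case False
        then have lt: "Sup L < c" using SLT by simp
        have "x \<le> Sup L" if "x \<in> T" "x < c" for x
          using that \<open>bdd_above L\<close> by (auto simp: L_def intro: cSup_upper)
        then have "fjump T (Sup L) = c" using T SLT lt cT by (intro fjump_eqI) force+
        moreover have "has_delta_deriv T G 0 (Sup L)" using d[OF SLT(1) SL(2)] lt cT by simp
        ultimately have "G c = G (Sup L)" using delta_deriv_jump[OF T SLT(1)] by force
        then have "\<bar>G c - G a\<bar> \<le> e * (Sup L - a)" using good[OF SLT(1) SL(2) lt] by simp
        also have "\<dots> \<le> e * (c - a)" using e SLT by simp
        finally show False using bad by simp
      next
        case True
        have "c islimpt L" using SL True by (auto simp: closure_def L_def)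
        then have nb: "at c within L \<noteq> bot" by (simp add: trivial_limit_within)
        have lim: "(G \<longlongrightarrow> G c) (at c within L)"
        proof (cases "c = b")
          case True then show ?thesis using assms(6) by (simp add: L_def)
        next
          case False
          then have "continuous (at c within T) G" 
            using cT d delta_deriv_continuous[OF T] by fastforce
          then show ?thesis unfolding continuous_within by (rule tendsto_within_subset) (auto simp: L_def)
        qed
        have "\<forall>\<^sub>F x in at c within L. a < x" 
          using order_tendstoD(1)[OF tendsto_ident_at \<open>a < c\<close>] .
        moreover have "\<forall>\<^sub>F x in at c within L. x \<in> L" by (simp add: eventually_at_filter)
        ultimately have ev: "\<forall>\<^sub>F x in at c within L. \<bar>G x - G a\<bar> \<le> e * (x - a)"
          by eventually_elim (use good in \<open>auto simp: L_def\<close>)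
        have "\<bar>G c - G a\<bar> \<le> e * (c - a)"
          by (rule tendsto_le[OF nb _ _ ev]) (intro tendsto_intros lim)+
        then show False using bad by simp
      qed
    next
      case False
      then have goodc: "\<bar>G c - G a\<bar> \<le> e * (c - a)" using cT by (auto simp: B_def)
      have "c < b" using False \<open>b \<in> B\<close> cT by (cases "c = b") auto
      have near: "\<exists>x\<in>B. c < x \<and> x < y" if y: "c < y" for y
      proof -
        obtain x where "x \<in> B" "x < y" using y \<open>b \<in> B\<close> bdd cInf_less_iff[of B y] unfolding c_def by blast
        then show ?thesis using lower[of x] False by (intro bexI[of _ x]) (auto simp: less_le)
      qed
      have "fjump T c = c"
      proof (rule ccontr)
        assume "fjump T c \<noteq> c"
        then obtain x where x: "x \<in> B" "c < x" "x < fjump T c" using near fjump_ge[OF cT(1)] by force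
        then show False using fjump_greatest[OF T cT(1), of x] by (auto simp: B_def)
      qed
      then obtain U where U: "open U" "c \<in> U" "\<forall>r\<in>U \<inter> T. \<bar>G c - G r\<bar> \<le> e * \<bar>c - r\<bar>"
        using d[OF cT(1,2) \<open>c < b\<close>] e unfolding has_delta_deriv_def by force
      then obtain d where "d > 0" "ball c d \<subseteq> U" by (meson openE)
      then obtain x where x: "x \<in> B" "c < x" "x < c + d" using near[of "c + d"] by auto
      then have "x \<in> U \<inter> T" using \<open>ball c d \<subseteq> U\<close> by (auto simp: B_def dist_real_def)
      then have "\<bar>G c - G x\<bar> \<le> e * \<bar>c - x\<bar>" using U by blast
      then have "\<bar>G x - G a\<bar> \<le> e * (x - a)" using goodc x by (auto simp: algebra_simps abs_if split: if_splits)
      then show False using x by (auto simp: B_def)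
    qed
  qed
  have "\<bar>G b - G a\<bar> \<le> 0 + e" if "e > 0" for e
  proof -
    have "\<bar>G b - G a\<bar> \<le> e / (b - a + 1) * (b - a)" using ab that by (intro main) auto
    also have "\<dots> \<le> e" using ab that by (simp add: field_simps)
    finally show ?thesis by simp
  qed
  then have "\<bar>G b - G a\<bar> \<le> 0" by (rule field_le_epsilon)
  then show ?thesis by simp
qed

section \<open>Existence of delta antiderivatives\<close>

text \<open>
  Composing with \<open>last_point T\<close> extends a function from \<open>T\<close> to the line by a constant on
  each gap of \<open>T\<close>. The value below \<open>Inf T\<close> is chosen so that \<open>last_point T\<close> is
  monotone everywhere, hence Borel measurable.
\<close>

definition last_point :: "real set \<Rightarrow> real \<Rightarrow> real" where
  "last_point T x = (if T \<inter> {..x} = {} then Inf T else Sup (T \<inter> {..x}))"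

lemma last_point_mem:
  assumes "time_scale T"
  shows "last_point T x \<in> T"
proof (cases "T \<inter> {..x} = {}")
  case True
  then have "bdd_below T" by (intro bdd_belowI[of _ x]) force
  then show ?thesis using True assms by (auto simp: last_point_def time_scale_def intro!: closed_contains_Inf)
next
  case False
  then have "Sup (T \<inter> {..x}) \<in> T \<inter> {..x}"
    using assms by (intro closed_contains_Sup) (auto simp: time_scale_def intro: bdd_aboveI[of _ x])
  then show ?thesis using False by (simp add: last_point_def)
qed

lemma last_point_ident:
  assumes "t \<in> T"
  shows "last_point T t = t"
proof -
  have "Sup (T \<inter> {..t}) = t" using assms by (intro cSup_eq_maximum) auto
  then show ?thesis using assms by (auto simp: last_point_def)
qed

lemma last_point_mono:
  assumes "time_scale T"
  shows "mono (last_point T)"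
proof (rule monoI)
  fix x y :: real assume "x \<le> y"
  show "last_point T x \<le> last_point T y"
  proof (cases "T \<inter> {..x} = {}")
    case True
    then have "bdd_below T" by (intro bdd_belowI[of _ x]) force
    then have "Inf T \<le> last_point T y" using last_point_mem[OF assms] by (intro cInf_lower)
    then show ?thesis using True by (simp add: last_point_def)
  next
    case False
    moreover have "Sup (T \<inter> {..x}) \<le> Sup (T \<inter> {..y})"
      using False \<open>x \<le> y\<close> by (intro cSup_subset_mono) (auto intro: bdd_aboveI[of _ y])
    moreover have "T \<inter> {..y} \<noteq> {}" using False \<open>x \<le> y\<close> by force
    ultimately show ?thesis by (auto simp: last_point_def)
  qed
qed

lemma last_point_gap:
  assumes "time_scale T" "t \<in> T" "t \<le> x" "x < fjump T t"
  shows "last_point T x = t"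
proof -
  have "r \<le> t" if "r \<in> T" "r \<le> x" for r
    using fjump_greatest[OF assms(1,2) that(1)] that assms by force
  then have "Sup (T \<inter> {..x}) = t" using assms by (intro cSup_eq_maximum) auto
  then show ?thesis using assms by (auto simp: last_point_def)
qed

text \<open>
  The antiderivative is the ordinary indefinite integral of the step extension
  \<open>f = F \<circ> \<tau> \<circ> last_point T\<close>: on a gap \<open>f\<close> is constant, which gives the jump
  formula, and where \<open>fjump T t = t\<close> the values of \<open>f\<close> between \<open>t\<close> and
  \<open>r \<in> T\<close> are values of \<open>F \<circ> \<tau>\<close> at points of \<open>T\<close> between \<open>t\<close> and
  \<open>r\<close>. The monotone map \<open>\<tau>\<close> stands for the identity or for \<open>fjump T\<close>; monotonicity
  makes \<open>f\<close> measurable and locally bounded although \<open>F \<circ> fjump T\<close> is merely rd-continuous.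
\<close>

lemma delta_antideriv_exists:
  assumes T: "time_scale T" and F: "continuous_on T F"
    and \<tau>: "mono_on T \<tau>" "\<tau> ` T \<subseteq> T"
      "\<And>t. t \<in> T \<Longrightarrow> fjump T t = t \<Longrightarrow> continuous (at t within T) \<tau>"
  shows "\<exists>G. \<forall>t\<in>T. has_delta_deriv T G (F (\<tau> t)) t"
proof -
  define \<beta> where "\<beta> = last_point T"
  have \<beta>: "\<beta> x \<in> T" "\<tau> (\<beta> x) \<in> T" for x
    using last_point_mem[OF T] \<tau> by (auto simp: \<beta>_def)
  have \<beta>_mono: "\<beta> x \<le> \<beta> y" if "x \<le> y" for x y
    using that last_point_mono[OF T] by (auto simp: \<beta>_def dest: monoD)
  have \<beta>_id: "\<beta> t = t" if "t \<in> T" for t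
    using that last_point_ident by (simp add: \<beta>_def)
  have \<tau>\<beta>: "mono (\<lambda>x. \<tau> (\<beta> x))"
    by (rule monoI) (rule mono_onD[OF \<tau>(1) \<beta>(1) \<beta>(1) \<beta>_mono])
  define f where "f = (\<lambda>x. F (\<tau> (\<beta> x)))"
  have f_T: "f t = F (\<tau> t)" if "t \<in> T" for t using that by (simp add: f_def \<beta>_id)
  have "(\<lambda>x. indicator T x *\<^sub>R F x) \<in> borel_measurable borel"
    using T F by (intro borel_measurable_continuous_on_indicator) (auto simp: time_scale_def)
  then have "(\<lambda>x. indicator T (\<tau> (\<beta> x)) *\<^sub>R F (\<tau> (\<beta> x))) \<in> borel_measurable borel"
    by (rule measurable_compose[OF borel_measurable_mono[OF \<tau>\<beta>]])
  moreover have "(\<lambda>x. indicator T (\<tau> (\<beta> x)) *\<^sub>R F (\<tau> (\<beta> x))) = f"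
    by (rule ext) (simp only: f_def indicator_simps \<beta>(2) scaleR_one)
  ultimately have f_meas: "f \<in> borel_measurable borel" by simp
  have f_bdd: "\<exists>M\<ge>0. \<forall>x\<in>{a..b}. \<bar>f x\<bar> \<le> M" for a b
  proof -
    have "compact (T \<inter> {\<tau> (\<beta> a)..\<tau> (\<beta> b)})"
      using T by (auto simp: time_scale_def intro: closed_Int_compact)
    then have "bounded (F ` (T \<inter> {\<tau> (\<beta> a)..\<tau> (\<beta> b)}))"
      by (intro compact_imp_bounded compact_continuous_image continuous_on_subset[OF F]) auto
    then obtain M where M: "M > 0" "\<And>y. y \<in> F ` (T \<inter> {\<tau> (\<beta> a)..\<tau> (\<beta> b)}) \<Longrightarrow> norm y \<le> M"
      by (auto simp: bounded_pos)
    have "\<bar>f x\<bar> \<le> M" if "x \<in> {a..b}" for x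
      using M(2)[of "f x"] \<beta>(2)[of x] monoD[OF \<tau>\<beta>, of a x] monoD[OF \<tau>\<beta>, of x b] that
      by (auto simp: f_def)
    then show ?thesis using M by (intro exI[of _ M]) auto
  qed
  have f_int: "f integrable_on {a..b}" for a b
  proof -
    obtain M where M: "\<forall>x\<in>{a..b}. \<bar>f x\<bar> \<le> M" using f_bdd by blast
    have "f \<in> borel_measurable lborel" using f_meas by simp
    then have "f \<in> borel_measurable (lebesgue_on {a..b})"
      by (rule measurable_restrict_space1[OF measurable_completion])
    then show ?thesis
    proof (rule measurable_bounded_by_integrable_imp_integrable)
      show "(\<lambda>_. M) integrable_on {a..b}" by (rule integrable_const_ivl)
      show "norm (f x) \<le> M" if "x \<in> {a..b}" for x using M that by simp
      show "{a..b} \<in> sets lebesgue" by simp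
    qed
  qed
  have close: "\<bar>integral {a..b} f - c * (b - a)\<bar> \<le> e * (b - a)"
    if "a \<le> b" "e \<ge> 0" "\<And>x. x \<in> {a..<b} \<Longrightarrow> \<bar>f x - c\<bar> \<le> e" for a b c e
  proof -
    have "((\<lambda>x. f x - c) has_integral (integral {a..b} f - c * (b - a))) {a..b}"
      using has_integral_diff[OF integrable_integral[OF f_int[of a b]] has_integral_const_real[of c a b]] that
      by (simp add: mult.commute)
    then have "norm (integral {a..b} f - c * (b - a)) \<le> e * measure lborel {a..b}"
      using that by (intro has_integral_bound_real[where S = "{b}"]) auto
    then show ?thesis using that by simp
  qed
  obtain t0 where "t0 \<in> T" using T by (auto simp: time_scale_def)
  define G where "G x = integral {t0..x} f - integral {x..t0} f" for x
  have G_diff: "G b - G a = integral {a..b} f" if "a \<le> b" for a b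
  proof -
    have sing: "integral {x..y} f = 0" if "y \<le> x" for x y
      using that by (cases "x = y") auto
    consider "t0 \<le> a" | "a \<le> t0" "t0 \<le> b" | "b \<le> t0" by linarith
    then show ?thesis
    proof cases
      case 1
      then show ?thesis 
        using Henstock_Kurzweil_Integration.integral_combine[OF 1 that f_int] that by (simp add: G_def sing)
    next
      case 2
      then show ?thesis 
        using Henstock_Kurzweil_Integration.integral_combine[OF 2 f_int] by (simp add: G_def sing)
    next
      case 3
      then show ?thesis 
        using Henstock_Kurzweil_Integration.integral_combine[OF that 3 f_int] that by (simp add: G_def sing)
    qed
  qed
  have local: "\<bar>G r - G t - c * (r - t)\<bar> \<le> e * \<bar>r - t\<bar>"
    if "e \<ge> 0" "\<And>x. min r t \<le> x \<Longrightarrow> x \<le> max r t \<Longrightarrow> \<bar>f x - c\<bar> \<le> e" for r t c e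
  proof (cases "t \<le> r")
    case True
    then show ?thesis using close[of t r e c] that G_diff[of t r] by simp
  next
    case False
    then have "\<bar>G t - G r - c * (t - r)\<bar> \<le> e * (t - r)" using close[of r t e c] that G_diff[of r t] by simp
    then show ?thesis using False by (simp add: algebra_simps abs_if split: if_splits)
  qed
  have "has_delta_deriv T G (F (\<tau> t)) t" if t: "t \<in> T" for t
    unfolding has_delta_deriv_iff[OF T t]
  proof (intro conjI impI)
    show "continuous (at t within T) G"
    proof -
      \<comment> \<open>The integral of a locally bounded function is locally Lipschitz.\<close>
      obtain M where M: "M \<ge> 0" "\<forall>x\<in>{t-1..t+1}. \<bar>f x\<bar> \<le> M" using f_bdd by blast
      have "\<forall>\<^sub>F r in at t within T. dist r t < 1"
        unfolding eventually_at by (intro exI[of _ 1]) auto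
      then have ev: "\<forall>\<^sub>F r in at t within T. norm (G r - G t) \<le> M * \<bar>r - t\<bar>"
      proof eventually_elim
        case (elim r)
        then have "\<bar>f x - 0\<bar> \<le> M" if "min r t \<le> x" "x \<le> max r t" for x
        proof -
          have "x \<in> {t-1..t+1}"
            using elim that unfolding dist_real_def atLeastAtMost_iff by linarith
          then show ?thesis using M(2) by simp
        qed
        then show ?case using local[of M r t 0] M(1) by simp
      qed
      have "((\<lambda>r. M * \<bar>r - t\<bar>) \<longlongrightarrow> M * \<bar>t - t\<bar>) (at t within T)"
        by (intro tendsto_intros)
      then have "((\<lambda>r. G r - G t) \<longlongrightarrow> 0) (at t within T)"
        by (intro Lim_null_comparison[OF ev]) simp
      then show ?thesis unfolding continuous_within by (simp add: LIM_zero_iff)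
    qed
    have "integral {t..fjump T t} f = f t * (fjump T t - t)"
    proof -
      have "\<bar>f x - f t\<bar> \<le> 0" if "x \<in> {t..<fjump T t}" for x
      proof -
        have "\<beta> x = t" "\<beta> t = t" using last_point_gap[OF T t, of x] that \<beta>_id[OF t] by (auto simp: \<beta>_def)
        then show ?thesis by (simp add: f_def)
      qed
      from close[OF fjump_ge[OF t] order.refl this] show ?thesis by simp
    qed
    then show "G (fjump T t) = G t + F (\<tau> t) * (fjump T t - t)"
      using G_diff[of t "fjump T t"] fjump_ge[OF t] by (simp add: f_T t)
    assume rd: "fjump T t = t"
    have "continuous (at (\<tau> t) within \<tau> ` T) F"
      using continuous_on_subset[OF F \<tau>(2)] t unfolding continuous_on_eq_continuous_within by blast
    from continuous_within_compose2[OF \<tau>(3)[OF t rd] this]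
    have F\<tau>_cont: "continuous (at t within T) (\<lambda>x. F (\<tau> x))" .
    show "(G has_real_derivative F (\<tau> t)) (at t within T)"
      unfolding has_field_derivative_def has_derivative_within_alt
    proof (intro conjI allI impI)
      fix e :: real assume e: "e > 0"
      then obtain d where d: "d > 0" "\<And>x. x \<in> T \<Longrightarrow> \<bar>x - t\<bar> < d \<Longrightarrow> \<bar>F (\<tau> x) - F (\<tau> t)\<bar> < e"
        using F\<tau>_cont 
        unfolding continuous_within_eps_delta dist_real_def by blast
      have "norm (G r - G t - F (\<tau> t) * (r - t)) \<le> e * norm (r - t)"
        if r: "r \<in> T" "norm (r - t) < d" for r
      proof -
        have "\<bar>f x - F (\<tau> t)\<bar> \<le> e" if x: "min r t \<le> x" "x \<le> max r t" for x
        proof -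
          have "min r t \<in> T" "max r t \<in> T" using r t by (auto simp: min_def max_def)
          then have "min r t \<le> \<beta> x" "\<beta> x \<le> max r t" 
            using \<beta>_mono[OF x(1)] \<beta>_mono[OF x(2)] by (simp_all only: \<beta>_id)
          then have "\<bar>\<beta> x - t\<bar> < d" using r by (auto simp: min_def max_def split: if_splits)
          then show ?thesis using d(2)[OF \<beta>(1)[of x]] by (auto simp: f_def intro: less_imp_le)
        qed
        then show ?thesis using local[of e r t "F (\<tau> t)"] e by simp
      qed
      then show "\<exists>d>0. \<forall>r\<in>T. norm (r - t) < d \<longrightarrow> norm (G r - G t - F (\<tau> t) * (r - t)) \<le> e * norm (r - t)"
        using d(1) by blast
    qed (rule bounded_linear_mult_right)
  qed
  then show ?thesis by blast
qed

section \<open>The iterates of kappa\<close>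

text \<open>
  Each application of \<open>kappa\<close> removes at most one isolated point at the top, so every iterate is
  the whole time scale or the part up to some point \<open>b\<close> that has a next point \<open>d\<close>. Isolating
  this shape avoids following the removed points individually.
\<close>

definition initial_part :: "real set \<Rightarrow> real set \<Rightarrow> bool" where
  "initial_part T S \<longleftrightarrow>
    S = T \<or> (\<exists>b\<in>T. \<exists>d\<in>T. b < d \<and> T \<inter> {b<..<d} = {} \<and> S = T \<inter> {..b})"

lemma initial_part_subset: "initial_part T S \<Longrightarrow> S \<subseteq> T"
  by (auto simp: initial_part_def)

lemma initial_part_downward:
  "initial_part T S \<Longrightarrow> x \<in> T \<Longrightarrow> y \<in> S \<Longrightarrow> x \<le> y \<Longrightarrow> x \<in> S"
  by (auto simp: initial_part_def)

lemma initial_part_trans: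
  assumes "initial_part T R" "initial_part R S"
  shows "initial_part T S"
proof (cases "S = R \<or> R = T")
  case True
  then show ?thesis using assms by auto
next
  case False
  then obtain c e where c: "c \<in> R" "e \<in> R" "c < e" "R \<inter> {c<..<e} = {}" "S = R \<inter> {..c}"
    using assms(2) by (auto simp: initial_part_def)
  have "T \<inter> {c<..<e} = {}"
  proof -
    have False if "x \<in> T" "c < x" "x < e" for x
      using initial_part_downward[OF assms(1) that(1) c(2)] that c(4) by auto
    then show ?thesis by auto
  qed
  moreover have "S = T \<inter> {..c}"
    using c(1,5) initial_part_downward[OF assms(1) _ c(1)] initial_part_subset[OF assms(1)] by auto
  ultimately show ?thesis
    using c(1-3) initial_part_subset[OF assms(1)] unfolding initial_part_def by blast
qed

lemma initial_part_time_scale: "initial_part T S \<Longrightarrow> time_scale T \<Longrightarrow> time_scale S"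
  by (auto simp: initial_part_def time_scale_def)

lemma initial_part_kappa:
  assumes T: "time_scale T"
  shows "initial_part T (kappa T)"
proof (cases "bdd_above T \<and> bjump T (Sup T) \<noteq> Sup T")
  case True
  define m where "m = Sup T"
  have m: "m \<in> T" using True T by (auto simp: m_def time_scale_def intro!: closed_contains_Sup)
  have le_m: "r \<le> m" if "r \<in> T" for r using True that by (auto simp: m_def intro: cSup_upper)
  have ne: "{r \<in> T. r < m} \<noteq> {}"
  proof
    assume e: "{r \<in> T. r < m} = {}"
    then have "Inf T = m" using m by (intro cInf_eq_minimum) force+
    then show False using True e by (simp add: bjump_def m_def)
  qed
  define c where "c = Sup {r \<in> T. r < m}"
  have bdd: "bdd_above {r \<in> T. r < m}" by (rule bdd_aboveI[of _ m]) auto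
  have "c \<in> closure {r \<in> T. r < m}" unfolding c_def using ne bdd by (intro closure_contains_Sup)
  also have "\<dots> \<subseteq> T \<inter> {..m}" using T by (intro closure_minimal closed_Int) (auto simp: time_scale_def)
  finally have "c \<in> T" "c \<le> m" by auto
  moreover have "c \<noteq> m"
  proof -
    have "bjump T m = c" using ne by (simp only: bjump_def c_def if_False simp_thms)
    then show ?thesis using True by (simp add: m_def)
  qed
  ultimately have c: "c \<in> T" "c < m" by auto
  have below: "r \<le> c" if "r \<in> T" "r < m" for r
    using that bdd by (auto simp: c_def intro: cSup_upper)
  have "kappa T = T - {m}" using True by (simp add: kappa_def m_def)
  also have "\<dots> = T \<inter> {..c}"
  proof (intro equalityI subsetI)
    fix r assume "r \<in> T - {m}"
    then show "r \<in> T \<inter> {..c}" using below[of r] le_m[of r] by simp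
  qed (use c in auto)
  finally have "kappa T = T \<inter> {..c}" .
  moreover have "T \<inter> {c<..<m} = {}" using below by fastforce
  ultimately show ?thesis using m c unfolding initial_part_def by blast
next
  case False
  then show ?thesis by (auto simp: kappa_def initial_part_def)
qed

lemma initial_part_kappa_iterate:
  assumes "time_scale T"
  shows "initial_part T ((kappa ^^ m) T)"
proof (induction m)
  case 0
  then show ?case by (simp add: initial_part_def)
next
  case (Suc m)
  then show ?case
    using initial_part_trans[OF Suc initial_part_kappa[OF initial_part_time_scale[OF Suc assms]]] by simp
qed

lemma kappa_memI:
  assumes "x \<in> S" "y \<in> S" "x < y"
  shows "x \<in> kappa S"
  using assms cSup_upper[of y S] by (auto simp: kappa_def)

section \<open>Evaluation of the delta integral\<close>

text \<open>
  The larger of the points \<open>a\<close> and \<open>b\<close> may be the maximum of \<open>S\<close> and missing from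
  \<open>kappa S\<close>. It is then isolated from the left, so the continuity demanded there is vacuous.
\<close>

lemma delta_deriv_zero_imp_eq_initial_part:
  assumes T: "time_scale T" and S: "initial_part T S" and ab: "a \<in> S" "b \<in> S"
    and H: "\<And>x. x \<in> kappa S \<Longrightarrow> has_delta_deriv T H 0 x"
  shows "H a = H b"
proof -
  have *: "H a = H b" if ab: "a \<in> S" "b \<in> S" "a \<le> b" for a b
  proof (rule delta_deriv_zero_imp_eq[OF T, where G = H])
    show "a \<in> T" "b \<in> T" "a \<le> b" using ab initial_part_subset[OF S] by auto
    show "has_delta_deriv T H 0 x" if "x \<in> T" "a \<le> x" "x < b" for x
      using that ab initial_part_downward[OF S] by (intro H kappa_memI[of _ _ b]) auto
    show "(H \<longlongrightarrow> H b) (at b within T \<inter> {..<b})"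
    proof (cases "b \<in> kappa S")
      case True
      then have "continuous (at b within T) H"
        using delta_deriv_continuous[OF T \<open>b \<in> T\<close>] H by blast
      then show ?thesis unfolding continuous_within by (rule tendsto_within_subset) auto
    next
      case False
      then have b: "b = Sup S" "bjump S b \<noteq> b" using ab by (auto simp: kappa_def split: if_splits)
      have inS: "r \<in> S" if "r \<in> T" "r < b" for r
        using initial_part_downward[OF S that(1) ab(2)] that(2) by simp
      have "\<exists>c<b. T \<inter> {c<..<b} = {}"
      proof (cases "{r \<in> S. r < b} = {}")
        case True
        then have "r \<notin> T" if "r < b" for r using inS[of r] that by blast
        then have "T \<inter> {b - 1<..<b} = {}" by auto
        then show ?thesis by (intro exI[of _ "b - 1"]) simp
      next
        case False
        define c where "c = Sup {r \<in> S. r < b}"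
        have "r \<le> c" if "r \<in> S" "r < b" for r
          unfolding c_def using that by (intro cSup_upper bdd_aboveI[of _ b]) auto
        then have "T \<inter> {c<..<b} = {}" using inS by (meson disjoint_iff greaterThanLessThan_iff not_less)
        moreover have "c \<le> b" unfolding c_def using False by (intro cSup_least) auto
        moreover have "c \<noteq> b" using b(2) False unfolding bjump_def c_def by (simp only: if_False simp_thms)
        ultimately show ?thesis by (intro exI[of _ c]) simp
      qed
      then obtain c' where c': "c' < b" "T \<inter> {c'<..<b} = {}" by (elim exE conjE)
      have "eventually P (at b within T \<inter> {..<b})" for P
        unfolding eventually_at_topological
      proof (intro exI conjI ballI impI)
        show "open {c'<..}" "b \<in> {c'<..}" using c'(1) by simp_all
        fix x assume "x \<in> {c'<..}" "x \<in> T \<inter> {..<b}"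
        then have "x \<in> T \<inter> {c'<..<b}" by simp
        then show "P x" unfolding c'(2) by (rule emptyE)
      qed
      then show ?thesis by (simp only: tendsto_def simp_thms)
    qed
  qed
  show ?thesis
  proof (cases "a \<le> b")
    case True
    then show ?thesis by (rule *[OF ab])
  next
    case False
    then have "b \<le> a" by simp
    from *[OF ab(2,1) this] show ?thesis by (rule sym)
  qed
qed

text \<open>
  The difference of two antiderivatives has derivative 0 on \<open>kappa S\<close>, hence takes the same
  value at \<open>s\<close> and \<open>t\<close>, so any antiderivative on \<open>kappa S\<close> computes the integral.
\<close>

lemma delta_integral_eq:
  assumes T: "time_scale T" and S: "initial_part T S" and st: "s \<in> S" "t \<in> S"
    and G: "delta_antideriv T (kappa S) g G"
  shows "delta_integral T (kappa S) s t g = G t - G s"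
  unfolding delta_integral_def
proof (rule the_equality)
  show "\<exists>G'. delta_antideriv T (kappa S) g G' \<and> G t - G s = G' t - G' s" using G by blast
  fix I assume "\<exists>G'. delta_antideriv T (kappa S) g G' \<and> I = G' t - G' s"
  then obtain G' where G': "delta_antideriv T (kappa S) g G'" "I = G' t - G' s" by blast
  have "kappa S \<subseteq> T"
    using initial_part_subset S initial_part_kappa initial_part_time_scale T by blast
  then have "has_delta_deriv T (\<lambda>x. G' x - G x) 0 x" if "x \<in> kappa S" for x
    using has_delta_deriv_diff[OF T, of x G' "g x" G "g x"] that G G' by (auto simp: delta_antideriv_def)
  from delta_deriv_zero_imp_eq_initial_part[OF T S st this]
  show "I = G t - G s" using G' by simp
qed

section \<open>Generalized monomials\<close>

lemma continuous_on_delta_deriv: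
  assumes "time_scale T" "\<And>t. t \<in> T \<Longrightarrow> has_delta_deriv T g (g' t) t"
  shows "continuous_on T g"
  unfolding continuous_on_eq_continuous_within using delta_deriv_continuous[OF assms(1)] assms(2) by blast

lemma monomial_h_deriv_and_start:
  assumes T: "time_scale T" and s: "s \<in> T"
  shows "monomial_h T (Suc k) s s = 0 \<and>
    (\<forall>t\<in>T. has_delta_deriv T (\<lambda>x. monomial_h T (Suc k) x s) (monomial_h T k t s) t)"
proof (induction k)
  have step: "monomial_h T (Suc k) s s = 0 \<and>
    (\<forall>t\<in>T. has_delta_deriv T (\<lambda>x. monomial_h T (Suc k) x s) (monomial_h T k t s) t)"
    if c: "continuous_on T (\<lambda>x. monomial_h T k x s)" for k
  proof -
    obtain G where G: "\<And>t. t \<in> T \<Longrightarrow> has_delta_deriv T G (monomial_h T k t s) t"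
      using delta_antideriv_exists[OF T c, of "\<lambda>x. x"] by (auto simp: mono_on_def)
    have "initial_part T T" by (simp add: initial_part_def)
    moreover have "delta_antideriv T (kappa T) (\<lambda>x. monomial_h T k x s) G"
      using G initial_part_subset[OF initial_part_kappa[OF T]] by (auto simp: delta_antideriv_def)
    ultimately have eq: "monomial_h T (Suc k) x s = G x - G s" if "x \<in> T" for x
      using delta_integral_eq[OF T _ s that] by simp
    have "has_delta_deriv T (\<lambda>x. monomial_h T (Suc k) x s) (monomial_h T k t s) t" if t: "t \<in> T" for t
      using has_delta_deriv_diff[OF T t G[OF t] has_delta_deriv_const[OF T t, of "G s"]]
        has_delta_deriv_cong[OF T t eq] by simp
    then show ?thesis using eq[OF s] by simp
  qed
  case 0
  then show ?case by (intro step) simp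
  case (Suc k)
  then show ?case by (intro step continuous_on_delta_deriv[OF T]) blast
qed

lemma monomial_h_deriv:
  assumes "time_scale T" "s \<in> T" "t \<in> T"
  shows "has_delta_deriv T (\<lambda>x. monomial_h T (Suc k) x s) (monomial_h T k t s) t"
  using monomial_h_deriv_and_start[OF assms(1,2)] assms(3) by blast

lemma monomial_h_same:
  assumes "time_scale T" "s \<in> T"
  shows "monomial_h T k s s = (if k = 0 then 1 else 0)"
  using monomial_h_deriv_and_start[OF assms] by (cases k) auto

text \<open>
  Monomials are defined by integration in their first argument; Taylor's formula needs their
  derivative in the second. Let \<open>G\<close> be an antiderivative of
  \<open>\<lambda>x. - monomial_h T k t (fjump T x)\<close>, normalised to vanish at \<open>t\<close>, and put
  \<open>v j = monomial_h T j t\<close> for \<open>j \<le> k\<close> and \<open>v (Suc k) = G\<close>. For fixed \<open>s\<close> the sum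
  \<open>W x\<close> of the products \<open>monomial_h T (Suc k - j) x s * v j x\<close> over \<open>j \<le> Suc k\<close>
  telescopes to derivative 0, so it is constant. At \<open>x = t\<close> and \<open>x = s\<close> all but one term
  vanish, and comparison yields \<open>monomial_h T (Suc k) t s = G s\<close>.
\<close>

lemma monomial_h_deriv_second:
  assumes T: "time_scale T" and t: "t \<in> T" and x: "x \<in> T"
  shows "has_delta_deriv T (\<lambda>s. monomial_h T (Suc k) t s) (- monomial_h T k t (fjump T x)) x"
  using x
proof (induction k arbitrary: x rule: less_induct)
  case (less k)
  have cont: "continuous_on T (\<lambda>s. monomial_h T k t s)"
  proof (cases k)
    case (Suc j)
    then show ?thesis using less.IH[of j] by (intro continuous_on_delta_deriv[OF T]) blast
  qed simp
  have "fjump T ` T \<subseteq> T" using fjump_mem[OF T] by blast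
  from delta_antideriv_exists[OF T continuous_on_minus[OF cont] fjump_mono[OF T] this
      fjump_continuous_right_dense[OF T]]
  obtain G where G: "\<And>x. x \<in> T \<Longrightarrow> has_delta_deriv T G (- monomial_h T k t (fjump T x)) x" by blast
  define v where "v j = (if j = Suc k then \<lambda>x. G x - G t else (\<lambda>s. monomial_h T j t s))" for j
  have v_deriv: "has_delta_deriv T (v (Suc j)) (- v j (fjump T x)) x" if "j \<le> k" "x \<in> T" for j x
    using less.IH[of j x] G[of x] that has_delta_deriv_diff[OF T _ G has_delta_deriv_const[OF T, of _ "G t"]]
    by (cases "j = k") (auto simp: v_def)
  have v_t: "v j t = (if j = 0 then 1 else 0)" for j
    using monomial_h_same[OF T t] by (auto simp: v_def)
  have eq: "monomial_h T (Suc k) t s = v (Suc k) s" if s: "s \<in> T" for s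
  proof -
    \<comment> \<open>The derivatives of the highest monomial in its first argument end with 0.\<close>
    define u where "u j = (\<lambda>x. if j \<le> Suc k then monomial_h T (Suc k - j) x s else 0)" for j
    have u_deriv: "has_delta_deriv T (u j) (u (Suc j) x) x" if "j \<le> Suc k" "x \<in> T" for j x
    proof (cases "j = Suc k")
      case True
      then show ?thesis using has_delta_deriv_const[OF T that(2)] by (simp add: u_def)
    next
      case False
      then have "Suc k - j = Suc (k - j)" using that by simp
      then show ?thesis using that False monomial_h_deriv[OF T s that(2), of "k - j"] 
        by (simp add: u_def del: monomial_h.simps)
    qed
    define W where "W = (\<lambda>x. \<Sum>j\<le>Suc k. u j x * v j x)"
    have "has_delta_deriv T W 0 x" if x: "x \<in> T" for x
    proof -
      have "has_delta_deriv T (v 0) 0 x" using has_delta_deriv_const[OF T x] by (simp add: v_def)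
      have "has_delta_deriv T W (u (Suc (Suc k)) x * v (Suc k) (fjump T x)) x"
        unfolding W_def
      proof (rule has_delta_deriv_telescope[OF T x, where u = u and v = v])
        show "has_delta_deriv T (u j) (u (Suc j) x) x" if "j \<le> Suc k" for j using u_deriv that x .
        show "has_delta_deriv T (v 0) 0 x" by fact
        show "has_delta_deriv T (v (Suc j)) (- v j (fjump T x)) x" if "j < Suc k" for j
          using v_deriv[of j x] that x by simp
      qed
      then show ?thesis by (simp add: u_def)
    qed
    then have "W t = W s"
      using delta_deriv_zero_imp_eq_initial_part[OF T _ t s, of W] 
        initial_part_subset[OF initial_part_kappa[OF T]] by (auto simp: initial_part_def)
    moreover have "W t = monomial_h T (Suc k) t s"
    proof -
      have "W t = (\<Sum>j\<le>Suc k. if j = 0 then u j t else 0)"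
        unfolding W_def by (intro sum.cong) (auto simp: v_t)
      then show ?thesis by (simp add: sum.delta u_def del: monomial_h.simps)
    qed
    moreover have "W s = v (Suc k) s"
    proof -
      have "W s = (\<Sum>j\<le>Suc k. if j = Suc k then v j s else 0)"
        unfolding W_def u_def by (intro sum.cong) (auto simp: monomial_h_same[OF T s] simp del: monomial_h.simps)
      then show ?thesis by (simp add: sum.delta)
    qed
    ultimately show ?thesis by simp
  qed
  show ?case
    using v_deriv[OF order.refl less.prems] has_delta_deriv_cong[OF T less.prems eq] by (simp add: v_def)
qed

section \<open>Higher derivatives as derivatives on the original time scale\<close>

lemma fjump_initial_part:
  assumes T: "time_scale T" and S: "initial_part T S" and x: "x \<in> S" "y \<in> S" "x < y"
  shows "fjump S x = fjump T x" "fjump T x \<in> S"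
proof -
  have xT: "x \<in> T" "y \<in> T" using x initial_part_subset[OF S] by auto
  have le: "fjump T x \<le> y" using fjump_greatest[OF T xT x(3)] .
  show S': "fjump T x \<in> S" by (rule initial_part_downward[OF S fjump_mem[OF T xT(1)] x(2) le])
  have sub: "{r \<in> S. x < r} \<subseteq> {r \<in> T. x < r}" using initial_part_subset[OF S] by auto
  have ne: "{r \<in> S. x < r} \<noteq> {}" using x by auto
  have bdd: "bdd_below {r \<in> T. x < r}" by (rule bdd_belowI[of _ x]) auto
  have "Inf {r \<in> S. x < r} = Inf {r \<in> T. x < r}"
  proof (rule antisym)
    show "Inf {r \<in> T. x < r} \<le> Inf {r \<in> S. x < r}" by (rule cInf_superset_mono[OF ne bdd sub])
    show "Inf {r \<in> S. x < r} \<le> Inf {r \<in> T. x < r}"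
    proof (rule cInf_greatest)
      show "{r \<in> T. x < r} \<noteq> {}" using ne sub by blast
      fix r assume r: "r \<in> {r \<in> T. x < r}"
      have bddS: "bdd_below {r \<in> S. x < r}" using bdd sub by (rule bdd_below_mono)
      show "Inf {r \<in> S. x < r} \<le> r"
      proof (cases "r \<le> y")
        case True
        then have "r \<in> S" using initial_part_downward[OF S _ x(2)] r by blast
        then show ?thesis using r by (intro cInf_lower[OF _ bddS]) auto
      next
        case False
        have "Inf {r \<in> S. x < r} \<le> y" using x by (intro cInf_lower[OF _ bddS]) auto
        then show ?thesis using False by simp
      qed
    qed
  qed
  moreover have "{r \<in> T. x < r} \<noteq> {}" using ne sub by blast
  ultimately show "fjump S x = fjump T x" using ne unfolding fjump_def by (simp only: if_False)
qed

lemma at_within_initial_part: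
  assumes S: "initial_part T S" and x: "x \<in> S"
  shows "at x within T = at x within S"
proof (cases "S = T")
  case False
  then obtain b d where b: "b < d" "T \<inter> {b<..<d} = {}" "S = T \<inter> {..b}"
    using S unfolding initial_part_def by blast
  have "T \<inter> {..<d} - {x} = S \<inter> {..<d} - {x}" using b by force
  then show ?thesis using b x by (intro at_within_nhd[of x "{..<d}"]) auto
qed simp

lemma initial_part_between:
  assumes "initial_part T R" "S \<subseteq> R" "initial_part T S"
  shows "initial_part R S"
proof (cases "S = T")
  case True
  then show ?thesis using assms initial_part_subset[OF assms(1)] by (auto simp: initial_part_def)
next
  case False
  then obtain b d where b: "b \<in> T" "d \<in> T" "b < d" "T \<inter> {b<..<d} = {}" "S = T \<inter> {..b}"
    using assms(3) unfolding initial_part_def by blast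
  have "b \<in> R" using b assms(2) by auto
  show ?thesis
  proof (cases "d \<in> R")
    case True
    then show ?thesis using b \<open>b \<in> R\<close> assms(2) initial_part_subset[OF assms(1)] 
      unfolding initial_part_def by blast
  next
    case False
    have "R \<subseteq> S"
    proof
      fix r assume r: "r \<in> R"
      then have "\<not> d \<le> r" using False initial_part_downward[OF assms(1) b(2)] by blast
      then show "r \<in> S" using b r initial_part_subset[OF assms(1)] by (auto simp: not_le)
    qed
    then show ?thesis using assms(2) by (auto simp: initial_part_def)
  qed
qed

text \<open>
  The derivative of order \<open>i\<close> lives on an iterate of \<open>kappa\<close>, whereas antiderivatives are
  taken with respect to \<open>T\<close>. If \<open>Sup S\<close> is left-dense in \<open>S\<close> but right-scattered in
  \<open>T\<close>, as the point 1 of \<open>{0..1} \<union> {2}\<close>, the derivative with respect to \<open>T\<close>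
  involves the value at a removed point. Continuing linearly above \<open>Sup S\<close>, with the derivative
  there as slope, supplies the value for which both derivatives agree.
\<close>

definition extend_linearly :: "real set \<Rightarrow> (real \<Rightarrow> real) \<Rightarrow> (real \<Rightarrow> real) \<Rightarrow> real \<Rightarrow> real" where
  "extend_linearly S f f' x = (if x \<in> S then f x else f (Sup S) + f' (Sup S) * (x - Sup S))"

text \<open>
  Below the maximum of \<open>S\<close> the sets \<open>S\<close>, \<open>R\<close> and \<open>T\<close> agree locally and have the
  same forward jump. At the maximum, either all three sets coincide or the jump in \<open>T\<close> leaves
  \<open>S\<close>, where the linear continuation satisfies the jump formula by construction.
\<close>

lemma has_delta_deriv_extend_linearly:
  assumes T: "time_scale T" and R: "initial_part T R" and S: "initial_part R S" and x: "x \<in> S"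
    and f: "has_delta_deriv R f (f' x) x"
  shows "has_delta_deriv T (extend_linearly S f f') (f' x) x"
proof -
  have TR: "time_scale R" by (rule initial_part_time_scale[OF R T])
  have TS: "initial_part T S" by (rule initial_part_trans[OF R S])
  have xR: "x \<in> R" and xT: "x \<in> T" using x initial_part_subset[OF S] initial_part_subset[OF TS] by auto
  have eq: "extend_linearly S f f' r = f r" if "r \<in> S" for r using that by (simp add: extend_linearly_def)
  have at: "at x within T = at x within S" "at x within R = at x within S"
    using at_within_initial_part[OF TS x] at_within_initial_part[OF S x] by auto
  have cont: "continuous (at x within T) (extend_linearly S f f')"
  proof -
    have "(f \<longlongrightarrow> f x) (at x within S)"
      using delta_deriv_continuous[OF TR xR f] unfolding continuous_within at .
    then have "(extend_linearly S f f' \<longlongrightarrow> f x) (at x within S)"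
      by (rule Lim_transform_within[of _ _ _ _ 1]) (auto simp: eq)
    then show ?thesis unfolding continuous_within at eq[OF x] .
  qed
  have deriv: "(extend_linearly S f f' has_real_derivative f' x) (at x within T)" if "fjump R x = x"
  proof -
    have "(f has_real_derivative f' x) (at x within S)"
      using f that unfolding has_delta_deriv_iff[OF TR xR] at by blast
    then show ?thesis
      unfolding at by (rule has_field_derivative_transform_within[where d = 1]) (use x eq in auto)
  qed
  show ?thesis
  proof (cases "\<exists>y\<in>S. x < y")
    case True
    then obtain y where y: "y \<in> S" "x < y" by blast
    have j: "fjump R x = fjump T x" "fjump T x \<in> S"
      using fjump_initial_part[OF TR S x y] fjump_initial_part[OF T TS x y] by auto
    have "f (fjump T x) = f x + f' x * (fjump T x - x)"
      using delta_deriv_jump[OF TR xR f] unfolding j(1) .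
    then show ?thesis
      unfolding has_delta_deriv_iff[OF T xT] using cont deriv j eq[OF x] eq[OF j(2)] by simp
  next
    case False
    then have "Sup S = x" using x by (intro cSup_eq_maximum) force+
    show ?thesis
    proof (cases "S = T")
      case True
      then have "R = T" using initial_part_subset[OF R] initial_part_subset[OF S] by auto
      then show ?thesis using f has_delta_deriv_cong[OF T xT, of "extend_linearly S f f'" f] eq True by simp
    next
      case nT: False
      then obtain b d where b: "b \<in> T" "d \<in> T" "b < d" "T \<inter> {b<..<d} = {}" "S = T \<inter> {..b}"
        using TS unfolding initial_part_def by blast
      have "b = x" using b x False by (auto simp: not_less intro: antisym)
      then have "fjump T x = d" "d \<notin> S" "x < d" using b by (auto intro!: fjump_eqI[OF T])
      then show ?thesis
        unfolding has_delta_deriv_iff[OF T xT]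
        using cont eq[OF x] \<open>Sup S = x\<close> by (simp add: extend_linearly_def x)
    qed
  qed
qed

section \<open>Taylor's formula and the integral equation\<close>

text \<open>
  Membership in \<open>Crdn\<close> provides some derivative at each point, and the value chosen by
  \<open>delta_deriv\<close> is one even where it is not unique, as on a one-point iterate of \<open>kappa\<close>.
\<close>

lemma Crdn_has_delta_deriv:
  assumes "y \<in> Crdn T n" "i < n" "t \<in> (kappa ^^ Suc i) T"
  shows "has_delta_deriv ((kappa ^^ i) T) (delta_derivs T i y) (delta_derivs T (Suc i) y t) t"
proof -
  have "\<exists>l. has_delta_deriv ((kappa ^^ i) T) (delta_derivs T i y) l t"
    using assms unfolding Crdn_def by blast
  then show ?thesis unfolding delta_derivs.simps delta_deriv_def by (rule someI_ex)
qed

lemma kappa_iterate_antimono: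
  assumes "time_scale T" "i \<le> j"
  shows "(kappa ^^ j) T \<subseteq> (kappa ^^ i) T"
  using assms(2)
proof (induction j rule: dec_induct)
  case (step j)
  then show ?case
    using initial_part_subset[OF initial_part_kappa[OF
        initial_part_time_scale[OF initial_part_kappa_iterate[OF assms(1), of j] assms(1)]]] by auto
qed simp

text \<open>
  Taylor's formula for the derivative of order \<open>i\<close> with remainder in integral form is the statement
  that the Taylor polynomial evaluated at \<open>t\<close>, as a function of its centre \<open>x\<close>, is an
  antiderivative of the remainder's integrand. One family \<open>u\<close> serves all \<open>i\<close>, so that the
  antiderivatives can be combined linearly.
\<close>

lemma taylor_remainder_antideriv:
  assumes T: "time_scale T" and y: "y \<in> Crdn T n" and S: "S = (kappa ^^ (n - 1)) T"
    and n: "n \<ge> 1" and t: "t \<in> T"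
  shows "\<exists>u. (\<forall>i<n. \<forall>x\<in>S. u i x = delta_derivs T i y x) \<and>
    (\<forall>i<n. delta_antideriv T (kappa S)
        (\<lambda>x. monomial_h T (n - i - 1) t (fjump T x) * delta_derivs T n y x)
        (\<lambda>x. \<Sum>k\<le>n - i - 1. u (k + i) x * monomial_h T k t x))"
proof -
  define u where "u i = (if i < n then extend_linearly S (delta_derivs T i y) (delta_derivs T (Suc i) y)
    else delta_derivs T n y)" for i
  have D: "kappa S = (kappa ^^ n) T" using n by (cases n) (auto simp: S)
  have TS: "initial_part T S" unfolding S by (rule initial_part_kappa_iterate[OF T])
  have DS: "kappa S \<subseteq> S"
    by (rule initial_part_subset[OF initial_part_kappa[OF initial_part_time_scale[OF TS T]]])
  have uS: "u i x = delta_derivs T i y x" if "i \<le> n" "x \<in> S" for i x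
    using that by (auto simp: u_def extend_linearly_def)
  have u_deriv: "has_delta_deriv T (u i) (u (Suc i) x) x" if i: "i < n" and x: "x \<in> kappa S" for i x
  proof -
    let ?R = "(kappa ^^ i) T"
    have R: "initial_part T ?R" by (rule initial_part_kappa_iterate[OF T])
    have "S \<subseteq> ?R" unfolding S using i by (intro kappa_iterate_antimono[OF T]) simp
    then have SR: "initial_part ?R S" by (rule initial_part_between[OF R _ TS])
    have "x \<in> (kappa ^^ Suc i) T"
      using x i kappa_iterate_antimono[OF T, of "Suc i" n] unfolding D by auto
    from Crdn_has_delta_deriv[OF y i this]
    have "has_delta_deriv T (u i) (delta_derivs T (Suc i) y x) x"
      using has_delta_deriv_extend_linearly[OF T R SR, of x "delta_derivs T i y" "delta_derivs T (Suc i) y"]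
        x DS i unfolding u_def by auto
    then show ?thesis using uS[of "Suc i" x] x DS i by auto
  qed
  have "has_delta_deriv T (\<lambda>x. \<Sum>k\<le>n - i - 1. u (k + i) x * monomial_h T k t x)
      (monomial_h T (n - i - 1) t (fjump T x) * delta_derivs T n y x) x"
    if i: "i < n" and x: "x \<in> kappa S" for i x
  proof -
    have xT: "x \<in> T" using x DS initial_part_subset[OF TS] by blast
    have v0: "has_delta_deriv T (monomial_h T 0 t) 0 x"
      using has_delta_deriv_const[OF T xT] by simp
    have "has_delta_deriv T (\<lambda>x. \<Sum>k\<le>n - i - 1. u (k + i) x * monomial_h T k t x)
      (u (Suc (n - i - 1) + i) x * monomial_h T (n - i - 1) t (fjump T x)) x"
    proof (rule has_delta_deriv_telescope[OF T xT, where u = "\<lambda>k. u (k + i)" and v = "\<lambda>k. monomial_h T k t"])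
      show "has_delta_deriv T (u (k + i)) (u (Suc k + i) x) x" if "k \<le> n - i - 1" for k
        using u_deriv[OF _ x, of "k + i"] that i by simp
      show "has_delta_deriv T (monomial_h T 0 t) 0 x" by fact
      show "has_delta_deriv T (monomial_h T (Suc k) t) (- monomial_h T k t (fjump T x)) x" for k
        by (rule monomial_h_deriv_second[OF T t xT])
    qed
    moreover have "u (Suc (n - i - 1) + i) x = delta_derivs T n y x" using i by (simp add: u_def)
    ultimately show ?thesis by (simp add: mult.commute)
  qed
  then show ?thesis using uS by (intro exI[of _ u]) (auto simp: delta_antideriv_def)
qed

theorem lemma4:
  fixes T :: "real set" and n :: nat and s :: real
    and p :: "nat \<Rightarrow> real \<Rightarrow> real" and q y :: "real \<Rightarrow> real" and y0 :: "nat \<Rightarrow> real"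
  assumes "time_scale T" and "n \<ge> 1" and "s \<in> (kappa ^^ (n - 1)) T"
    and "\<forall>i\<in>{1..n}. p i \<in> Crd T" and "q \<in> Crd T"
    and "y \<in> Crdn T n"
    and "\<forall>t\<in>(kappa ^^ n) T.
           delta_derivs T n y t + (\<Sum>i<n. p (n - i) t * delta_derivs T i y t) = q t"
    and "\<forall>i<n. delta_derivs T i y s = y0 i"
  shows "\<forall>t\<in>(kappa ^^ n) T.
           delta_derivs T n y t =
             - delta_integral T ((kappa ^^ n) T) s t
                 (\<lambda>\<eta>. \<Sum>i<n. p (n - i) t * monomial_h T (n - i - 1) t (fjump T \<eta>)
                                * delta_derivs T n y \<eta>)
             + q t
             - (\<Sum>i<n. \<Sum>k\<le>n - i - 1. y0 (k + i) * p (n - i) t * monomial_h T k t s)"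
proof
  fix t assume tD: "t \<in> (kappa ^^ n) T"
  note T = assms(1)
  define S where "S = (kappa ^^ (n - 1)) T"
  have D: "kappa S = (kappa ^^ n) T"
    using assms(2) by (cases n) (auto simp: S_def)
  have TS: "initial_part T S" unfolding S_def by (rule initial_part_kappa_iterate[OF T])
  have DS: "kappa S \<subseteq> S"
    by (rule initial_part_subset[OF initial_part_kappa[OF initial_part_time_scale[OF TS T]]])
  have s: "s \<in> S" using assms(3) by (simp add: S_def)
  have t: "t \<in> S" "t \<in> T" using tD D DS initial_part_subset[OF TS] by auto
  obtain u where u: "\<And>i x. i < n \<Longrightarrow> x \<in> S \<Longrightarrow> u i x = delta_derivs T i y x"
    and anti: "\<And>i. i < n \<Longrightarrow> delta_antideriv T (kappa S)
        (\<lambda>x. monomial_h T (n - i - 1) t (fjump T x) * delta_derivs T n y x)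
        (\<lambda>x. \<Sum>k\<le>n - i - 1. u (k + i) x * monomial_h T k t x)"
    using taylor_remainder_antideriv[OF T assms(6) S_def assms(2) t(2)] by blast
  define F where "F x = (\<Sum>i<n. p (n - i) t * (\<Sum>k\<le>n - i - 1. u (k + i) x * monomial_h T k t x))" for x
  have "delta_antideriv T (kappa S)
     (\<lambda>x. \<Sum>i<n. p (n - i) t * (monomial_h T (n - i - 1) t (fjump T x) * delta_derivs T n y x)) F"
    unfolding delta_antideriv_def
  proof
    fix x assume x: "x \<in> kappa S"
    then have xT: "x \<in> T" using DS initial_part_subset[OF TS] by blast
    show "has_delta_deriv T F
      (\<Sum>i<n. p (n - i) t * (monomial_h T (n - i - 1) t (fjump T x) * delta_derivs T n y x)) x"
      unfolding F_def
    proof (rule has_delta_deriv_sum[OF T xT finite_lessThan])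
      fix i assume "i \<in> {..<n}"
      then have "has_delta_deriv T (\<lambda>x. \<Sum>k\<le>n - i - 1. u (k + i) x * monomial_h T k t x)
        (monomial_h T (n - i - 1) t (fjump T x) * delta_derivs T n y x) x"
        using anti x unfolding delta_antideriv_def by blast
      then show "has_delta_deriv T (\<lambda>x. p (n - i) t * (\<Sum>k\<le>n - i - 1. u (k + i) x * monomial_h T k t x))
        (p (n - i) t * (monomial_h T (n - i - 1) t (fjump T x) * delta_derivs T n y x)) x"
        by (rule has_delta_deriv_cmult[OF T xT])
    qed
  qed
  from delta_integral_eq[OF T TS s t(1) this]
  have int: "delta_integral T ((kappa ^^ n) T) s t
      (\<lambda>\<eta>. \<Sum>i<n. p (n - i) t * monomial_h T (n - i - 1) t (fjump T \<eta>) * delta_derivs T n y \<eta>) = F t - F s"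
    unfolding D by (simp only: mult.assoc)
  \<comment> \<open>At centre \<open>t\<close> the Taylor polynomials reduce to their constant terms.\<close>
  have "F t = (\<Sum>i<n. p (n - i) t * delta_derivs T i y t)"
    unfolding F_def
  proof (intro sum.cong arg_cong2[where f = times] refl)
    fix i assume i: "i \<in> {..<n}"
    have "(\<Sum>k\<le>n - i - 1. u (k + i) t * monomial_h T k t t) = (\<Sum>k\<le>n - i - 1. if k = 0 then u (k + i) t else 0)"
      by (intro sum.cong) (simp_all add: monomial_h_same[OF T t(2)])
    then show "(\<Sum>k\<le>n - i - 1. u (k + i) t * monomial_h T k t t) = delta_derivs T i y t"
      using u[of i t] i t(1) by (simp add: sum.delta)
  qed
  moreover have "F s = (\<Sum>i<n. \<Sum>k\<le>n - i - 1. y0 (k + i) * p (n - i) t * monomial_h T k t s)"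
    unfolding F_def sum_distrib_left
  proof (intro sum.cong refl)
    fix i k assume "i \<in> {..<n}" "k \<in> {..n - i - 1}"
    then have "k + i < n" by auto
    then have "u (k + i) s = y0 (k + i)" using u[OF _ s] assms(8) by simp
    then show "p (n - i) t * (u (k + i) s * monomial_h T k t s) = y0 (k + i) * p (n - i) t * monomial_h T k t s"
      by simp
  qed
  moreover have "delta_derivs T n y t + (\<Sum>i<n. p (n - i) t * delta_derivs T i y t) = q t"
    using assms(7) tD by blast
  ultimately show "delta_derivs T n y t =
             - delta_integral T ((kappa ^^ n) T) s t
                 (\<lambda>\<eta>. \<Sum>i<n. p (n - i) t * monomial_h T (n - i - 1) t (fjump T \<eta>)
                                * delta_derivs T n y \<eta>)
             + q t
             - (\<Sum>i<n. \<Sum>k\<le>n - i - 1. y0 (k + i) * p (n - i) t * monomial_h T k t s)"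
    unfolding int by linarith
qed

end
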